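(* Let $K(r)$ be a $2$-bridge knot belonging to $H(3)$. Then the twisted Alexander polynomial of $K(r)$ associated to $\rho_0$ satisfies $$\widetilde{\Delta}_{\rho_0,K(r)}(t)=\varphi(t^{\pm 3}),$$ where $\varphi$ is an integer polynomial; that is, $\widetilde{\Delta}_{\rho_0,K(r)}(t)$ is an integer (Laurent) polynomial in $t^3$.
   Context: For a rational number $r=\beta/\alpha$, $0<r<1$, with $\alpha\equiv\beta\equiv 1 \pmod 2$ and $\gcd(\alpha,\beta)=1$, let $K(r)$ denote the corresponding $2$-bridge knot and $G(K(r))$ its knot group, with the standard two-generator Wirtinger presentation $G(K(r))=\langle x,y\mid R\rangle$, $R=WxW^{-1}y^{-1}$, where $x,y$ are meridian generators and $W$ is a word in $x,y$. $H(3)$ is the set of those $K(r)$ such that $G(K(r))$ maps onto a non-trivial free product $\mathbb{Z}/2*\mathbb{Z}/3$. It is a known fact, used as part of the setting, that for $K(r)\in H(3)$ the relator $R$ is, in the free group $F(x,y)$, a product of conjugates of $R_0^{\pm1}$, where $R_0=xyxy^{-1}x^{-1}y^{-1}$. Consequently, for $K(r)\in H(3)$ there is a homomorphism $\rho:G(K(r))\to A_4$ with $\rho(x)=(123)$, $\rho(y)=(142)$. Let $\xi_0:A_4\to GL(3,\mathbb{Z})$ be the irreducible representation given by $$\xi_0(123)=X=\begin{pmatrix}-1&1&0\\-1&0&0\\-1&0&1\end{pmatrix},\qquad \xi_0(142)=Y=\begin{pmatrix}0&0&-1\\0&1&-1\\1&0&-1\end{pmatrix}.$$ The representation $\rho_0:G(K(r))\to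 GL(3,\mathbb{Z})$ is $\rho$ followed by $\xi_0$, so $\rho_0(x)=X$ and $\rho_0(y)=Y$. The twisted Alexander polynomial (in the sense of Wada) is $$\widetilde{\Delta}_{\rho_0,K(r)}(t)=\frac{\det\Phi\left(\frac{\partial R}{\partial x}\right)}{\det\Phi(y-1)},$$ where $\partial/\partial x$ is the Fox free derivative and $\Phi:\mathbb{Z}F(x,y)\to M_{3,3}(\mathbb{Z}[t^{\pm1}])$ is the ring homomorphism with $\Phi(x)=Xt$, $\Phi(y)=Yt$. It is defined up to multiplication by $\pm t^k$, $k\in\mathbb{Z}$, and the equality in the claim is understood up to such a factor. *)

theory Defs
  imports
    "HOL-Analysis.Analysis"
    "HOL-Algebra.Algebra"
    "HOL-Library.Poly_Mapping"
    "HOL-Computational_Algebra.Computational_Algebra"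
begin

section \<open>Free groups\<close>

text \<open>
  The letter \<open>(a, True)\<close> stands for the generator \<open>a\<close>, the letter \<open>(a, False)\<close> for its inverse.
  Elements of the free group are the freely reduced words.
\<close>

type_synonym 'a letter = "'a \<times> bool"

definition flip :: "'a letter \<Rightarrow> 'a letter" where
  "flip l = (fst l, \<not> snd l)"

definition freely_reduced :: "'a letter list \<Rightarrow> bool" where
  "freely_reduced w \<longleftrightarrow> successively (\<lambda>l m. m \<noteq> flip l) w"

fun push :: "'a letter \<Rightarrow> 'a letter list \<Rightarrow> 'a letter list" where
  "push l [] = [l]"
| "push l (m # w) = (if m = flip l then w else l # m # w)"

lemma flip_flip [simp]: "flip (flip l) = l"
  by (simp add: flip_def)

lemma flip_neq [simp]: "flip l \<noteq> l" "l \<noteq> flip l"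
  by (cases l; simp add: flip_def)+

lemma reduced_Nil [simp]: "freely_reduced []"
  by (simp add: freely_reduced_def)

lemma reduced_single [simp]: "freely_reduced [l]"
  by (simp add: freely_reduced_def)

lemma reduced_Cons2 [simp]: "freely_reduced (l # m # w) \<longleftrightarrow> m \<noteq> flip l \<and> freely_reduced (m # w)"
  by (simp add: freely_reduced_def)

lemma reduced_tl: "freely_reduced (l # w) \<Longrightarrow> freely_reduced w"
  by (cases w) auto

lemma reduced_push [simp]: "freely_reduced w \<Longrightarrow> freely_reduced (push l w)"
  by (cases w) (auto dest: reduced_tl)

lemma push_flip [simp]: "freely_reduced w \<Longrightarrow> push l (push (flip l) w) = w"
  by (induction w rule: induct_list012) auto

lemma push_reduced: "freely_reduced (l # w) \<Longrightarrow> push l w = l # w"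
  by (cases w) auto

lemma reduced_foldr_push [simp]: "freely_reduced w \<Longrightarrow> freely_reduced (foldr push u w)"
  by (induction u) auto

lemma foldr_push_Nil: "freely_reduced w \<Longrightarrow> foldr push w [] = w"
proof (induction w)
  case (Cons l w)
  then show ?case using reduced_tl[of l w] push_reduced[of l w] by simp
qed simp

lemma foldr_push_push:
  assumes "freely_reduced w"
  shows "foldr push (push l u) w = push l (foldr push u w)"
proof (cases u)
  case (Cons m u')
  then show ?thesis
    using assms push_flip[of "foldr push u' w" l] by auto
qed simp

lemma foldr_push_assoc:
  "freely_reduced w \<Longrightarrow> foldr push (foldr push u v) w = foldr push u (foldr push v w)"
  by (induction u) (auto simp: foldr_push_push)

lemma foldr_push_inverse:
  "freely_reduced v \<Longrightarrow> foldr push (rev (map flip u)) (foldr push u v) = v"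
  by (induction u arbitrary: v) (auto simp: push_flip[of _ "flip l" for l, simplified])

lemma reduced_inverse: "freely_reduced w \<Longrightarrow> freely_reduced (rev (map flip w))"
  unfolding freely_reduced_def successively_rev successively_map
  by (erule successively_mono) auto

typedef 'a free_group = "{w :: 'a letter list. freely_reduced w}"
  morphisms word Abs_free_group
  by (rule exI[of _ "[]"]) simp

setup_lifting type_definition_free_group

lift_definition of_letter :: "'a letter \<Rightarrow> 'a free_group" is "\<lambda>l. [l]"
  by simp

abbreviation gen :: "'a \<Rightarrow> 'a free_group" where
  "gen a \<equiv> of_letter (a, True)"

text \<open>
  The group operation is written additively, although it is not commutative: integral group rings
  are provided by \<^theory>\<open>HOL-Library.Poly_Mapping\<close>, which takes the exponents of the formal
  monomials from an additive monoid. Thus \<open>u + v\<close>, \<open>- u\<close> and \<open>u - v\<close> are the products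
  \<open>u v\<close>, \<open>u\<close> inverse, and \<open>u\<close> times \<open>v\<close> inverse.
\<close>

instantiation free_group :: (type) group_add
begin

lift_definition zero_free_group :: "'a free_group" is "[]"
  by simp

lift_definition plus_free_group :: "'a free_group \<Rightarrow> 'a free_group \<Rightarrow> 'a free_group" is
  "\<lambda>u v. foldr push u v"
  by simp

lift_definition uminus_free_group :: "'a free_group \<Rightarrow> 'a free_group" is
  "\<lambda>w. rev (map flip w)"
  by (rule reduced_inverse)

definition minus_free_group :: "'a free_group \<Rightarrow> 'a free_group \<Rightarrow> 'a free_group" where
  "minus_free_group u v = u + - v"

instance
proof
  fix a b c :: "'a free_group"
  show "a + b + c = a + (b + c)"
    by transfer (simp add: foldr_push_assoc)
  show "0 + a = a"
    by transfer simp
  show "a + 0 = a"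
    by transfer (simp add: foldr_push_Nil)
  show "- a + a = 0"
    by transfer (metis foldr_push_Nil foldr_push_inverse reduced_Nil)
  show "a + - b = a - b"
    by (simp add: minus_free_group_def)
qed

end

lemma uminus_gen: "- gen a = of_letter (a, False)"
  by transfer (simp add: flip_def)


section \<open>Presented groups and free products\<close>

definition full_free_group :: "'a free_group monoid" where
  "full_free_group = \<lparr>carrier = UNIV, mult = (+), one = 0\<rparr>"

lemma group_full_free_group: "group (full_free_group :: 'a free_group monoid)"
  by (rule groupI) (auto simp: full_free_group_def add.assoc intro: left_minus)

definition free_group_on :: "'a set \<Rightarrow> 'a free_group monoid" where
  "free_group_on S = full_free_group\<lparr>carrier := generate full_free_group (gen ` S)\<rparr>"

lemma group_free_group_on: "group (free_group_on S)"
  unfolding free_group_on_def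
  by (rule group.subgroup_imp_group[OF group_full_free_group],
      rule group.generate_is_subgroup[OF group_full_free_group])
     (simp add: full_free_group_def)

definition normal_closure :: "('g, 'm) monoid_scheme \<Rightarrow> 'g set \<Rightarrow> 'g set" where
  "normal_closure G R =
     generate G {g \<otimes>\<^bsub>G\<^esub> r \<otimes>\<^bsub>G\<^esub> inv\<^bsub>G\<^esub> g | g r. g \<in> carrier G \<and> r \<in> R}"

definition presented_group :: "'a set \<Rightarrow> 'a free_group set \<Rightarrow> 'a free_group set monoid" where
  "presented_group S R = free_group_on S Mod normal_closure (free_group_on S) R"

text \<open>
  The free product is presented by all elements of both factors, subject to the two multiplication
  tables.
\<close>

definition free_product ::
  "('a, 'm) monoid_scheme \<Rightarrow> ('b, 'n) monoid_scheme \<Rightarrow> ('a + 'b) free_group set monoid" where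
  "free_product G H = presented_group (Inl ` carrier G \<union> Inr ` carrier H)
     ({gen (Inl a) + gen (Inl b) - gen (Inl (a \<otimes>\<^bsub>G\<^esub> b)) | a b. a \<in> carrier G \<and> b \<in> carrier G} \<union>
      {gen (Inr a) + gen (Inr b) - gen (Inr (a \<otimes>\<^bsub>H\<^esub> b)) | a b. a \<in> carrier H \<and> b \<in> carrier H})"


section \<open>Two-bridge knot groups\<close>

datatype meridian = MX | MY

text \<open>
  \<open>W = x^e(1) y^e(2) x^e(3) \<dots> y^e(\<alpha> - 1)\<close>, where \<open>e(i)\<close> is \<open>-1\<close> to the power
  \<open>\<lfloor>i \<beta> / \<alpha>\<rfloor>\<close>.
\<close>

definition two_bridge_W :: "nat \<Rightarrow> nat \<Rightarrow> meridian free_group" where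
  "two_bridge_W \<alpha> \<beta> =
     (\<Sum>i\<leftarrow>[1..<\<alpha>]. of_letter (if odd i then MX else MY, even (i * \<beta> div \<alpha>)))"

definition two_bridge_R :: "nat \<Rightarrow> nat \<Rightarrow> meridian free_group" where
  "two_bridge_R \<alpha> \<beta> = two_bridge_W \<alpha> \<beta> + gen MX - two_bridge_W \<alpha> \<beta> - gen MY"

lemma two_bridge_R_trefoil: "two_bridge_R 3 1 = gen MX + gen MY + gen MX - gen MY - gen MX - gen MY"
proof -
  have "[1..<3] = [1,2::nat]" by (simp add: upt_rec)
  then have "two_bridge_W 3 1 = gen MX + gen MY" unfolding two_bridge_W_def by simp
  then show ?thesis by (simp add: two_bridge_R_def diff_conv_add_uminus add.assoc minus_add del: add_uminus_conv_diff)
qed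

definition two_bridge_knot_group :: "nat \<Rightarrow> nat \<Rightarrow> meridian free_group set monoid" where
  "two_bridge_knot_group \<alpha> \<beta> = presented_group UNIV {two_bridge_R \<alpha> \<beta>}"

definition in_H3 :: "nat \<Rightarrow> nat \<Rightarrow> bool" where
  "in_H3 \<alpha> \<beta> \<longleftrightarrow>
     epi (two_bridge_knot_group \<alpha> \<beta>)
         (free_product (integer_mod_group 2) (integer_mod_group 3)) \<noteq> {}"


section \<open>Fox calculus\<close>

type_synonym 'a group_ring = "'a free_group \<Rightarrow>\<^sub>0 int"

abbreviation grp :: "'a free_group \<Rightarrow> 'a group_ring" where
  "grp g \<equiv> Poly_Mapping.single g 1"

fun fox_letter :: "'a \<Rightarrow> 'a letter \<Rightarrow> 'a group_ring" where
  "fox_letter a (b, e) =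
     (if b \<noteq> a then 0 else if e then 1 else - grp (of_letter (b, False)))"

fun fox_word :: "'a \<Rightarrow> 'a letter list \<Rightarrow> 'a group_ring" where
  "fox_word a [] = 0"
| "fox_word a (l # w) = fox_letter a l + grp (of_letter l) * fox_word a w"

text \<open>The Fox derivative with respect to the generator \<open>a\<close>, on elements of the free group.\<close>

definition fox :: "'a \<Rightarrow> 'a free_group \<Rightarrow> 'a group_ring" where
  "fox a g = fox_word a (word g)"

lemma fox_gen: "fox a (gen b) = (if a = b then 1 else 0)"
  by (simp add: fox_def of_letter.rep_eq)

lemma fox_word_push: "fox_word a (push l w) = fox_letter a l + grp (of_letter l) * fox_word a w"
proof (cases "\<exists>w'. w = flip l # w'")
  case True
  then obtain w' where w: "w = flip l # w'" by blast
  have c: "of_letter l + of_letter (flip l) = 0"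
    by transfer simp
  have "fox_letter a l + grp (of_letter l) * fox_letter a (flip l) = 0"
  proof (cases l)
    case (Pair b e)
    then show ?thesis
      using c by (cases e) (auto simp: flip_def mult_single)
  qed
  moreover have "grp (of_letter l) * (grp (of_letter (flip l)) * z) = z" for z :: "'a group_ring"
    by (simp add: mult.assoc[symmetric] mult_single c)
  ultimately show ?thesis
    using w by (simp add: distrib_left add.assoc[symmetric])
next
  case False
  then show ?thesis by (cases w) auto
qed

theorem fox_add: "fox a (u + v) = fox a u + grp u * fox a v"
proof -
  have "fox_word a (foldr push x y) = fox_word a x + grp (Abs_free_group x) * fox_word a y"
    if "freely_reduced x" for x y
    using that
  proof (induction x)
    case Nil
    then show ?case by (simp add: zero_free_group_def[symmetric])
  next
    case (Cons l x)
    have r: "freely_reduced x" using Cons.prems reduced_tl by blast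
    have "word (of_letter l + Abs_free_group x) = l # x"
      using Cons.prems r
      by (simp add: plus_free_group.rep_eq of_letter.rep_eq Abs_free_group_inverse push_reduced)
    then have "Abs_free_group (l # x) = of_letter l + Abs_free_group x"
      using word_inverse by metis
    then have "grp (Abs_free_group (l # x)) = grp (of_letter l) * grp (Abs_free_group x)"
      by (simp add: mult_single)
    then show ?case
      using Cons r by (simp add: fox_word_push distrib_left mult.assoc add.assoc)
  qed
  from this[of "word u" "word v"] show ?thesis
    using word[of u] by (simp add: fox_def plus_free_group.rep_eq word_inverse)
qed


section \<open>Wada's twisted Alexander polynomial\<close>

text \<open>The ring of integral Laurent polynomials in \<open>t\<close>, as the group ring of the integers.\<close>

type_synonym laurent = "int \<Rightarrow>\<^sub>0 int"

abbreviation t_pow :: "int \<Rightarrow> laurent" where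
  "t_pow k \<equiv> Poly_Mapping.single k 1"

definition times_t :: "int^'n^'n \<Rightarrow> laurent^'n^'n" where
  "times_t A = (\<chi> i j. of_int (A $ i $ j) * t_pow 1)"

fun letter_matrix :: "('a \<Rightarrow> int^'n^'n) \<Rightarrow> 'a letter \<Rightarrow> laurent^'n^'n" where
  "letter_matrix A (a, e) = (if e then times_t (A a) else matrix_inv (times_t (A a)))"

definition element_matrix :: "('a \<Rightarrow> int^'n^'n) \<Rightarrow> 'a free_group \<Rightarrow> laurent^'n^'n" where
  "element_matrix A g = foldr (\<lambda>l M. letter_matrix A l ** M) (word g) (mat 1)"

text \<open>
  For matrices \<open>A a\<close> that are invertible over the integers, this is the ring homomorphism that maps
  each generator \<open>a\<close> to \<open>A a\<close> times \<open>t\<close>.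
\<close>

definition Phi :: "('a \<Rightarrow> int^'n^'n) \<Rightarrow> 'a group_ring \<Rightarrow> laurent^'n^'n" where
  "Phi A p = (\<Sum>g\<in>Poly_Mapping.keys p.
     mat (of_int (Poly_Mapping.lookup p g)) ** element_matrix A g)"

lemma mat_mult_left: "mat (c::'b::comm_ring_1) ** M = (\<chi> i j. c * (M::'b^'n^'n) $ i $ j)"
  by (simp add: mat_def matrix_matrix_mult_def if_distrib if_distribR cong: if_cong)

lemma Phi_superset:
  assumes "finite S" "Poly_Mapping.keys p \<subseteq> S"
  shows "Phi A p = (\<Sum>g\<in>S. mat (of_int (Poly_Mapping.lookup p g)) ** element_matrix A g)"
  unfolding Phi_def using assms
  by (intro sum.mono_neutral_left) (auto simp: in_keys_iff)

lemma Phi_add: "Phi A (p + q) = Phi A p + Phi A q"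
proof -
  let ?S = "Poly_Mapping.keys p \<union> Poly_Mapping.keys q"
  have "Phi A (p+q) = (\<Sum>g\<in>?S. mat (of_int (Poly_Mapping.lookup (p+q) g)) ** element_matrix A g)"
    using Poly_Mapping.keys_add[of p q] by (intro Phi_superset) auto
  also have "\<dots> = (\<Sum>g\<in>?S. mat (of_int (Poly_Mapping.lookup p g)) ** element_matrix A g) +
     (\<Sum>g\<in>?S. mat (of_int (Poly_Mapping.lookup q g)) ** element_matrix A g)"
    by (simp add: sum.distrib[symmetric] lookup_add mat_mult_left vec_eq_iff distrib_right)
  also have "\<dots> = Phi A p + Phi A q"
    by (subst (1 2) Phi_superset[of ?S]) auto
  finally show ?thesis .
qed

lemma Phi_single: "Phi A (Poly_Mapping.single g c) = mat (of_int c) ** element_matrix A g"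
  by (cases "c = 0") (auto simp: Phi_def mat_mult_left vec_eq_iff)

lemma Phi_minus: "Phi A (p - q) = Phi A p - Phi A q"
  using Phi_add[of A "p - q" q] by simp

lemma Phi_one: "Phi A 1 = mat 1"
  using Phi_single[of A 0 1] by (simp add: element_matrix_def zero_free_group.rep_eq)

lemma Phi_gen: "Phi A (grp (gen a)) = times_t (A a)"
  by (simp add: Phi_single element_matrix_def of_letter.rep_eq)

lemma matrix_inv_inverse: "invertible A \<Longrightarrow> A ** matrix_inv A = mat 1 \<and> matrix_inv A ** A = mat 1"
  unfolding invertible_def matrix_inv_def by (rule someI_ex)

lemma invertible_times_t:
  assumes "invertible (A::int^'n^'n)" shows "invertible (times_t A)"
proof -
  obtain B where B: "A ** B = mat 1" "B ** A = mat 1" using assms unfolding invertible_def by auto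
  define C :: "laurent^'n^'n" where "C = (\<chi> i j. of_int (B $ i $ j) * t_pow (-1))"
  have tt: "t_pow 1 * t_pow (-1) = 1" "t_pow (-1) * t_pow 1 = 1" by (simp_all add: mult_single)
  have e: "(of_int a * t_pow k) * (of_int b * t_pow m) = of_int (a * b) * (t_pow k * t_pow m)" for a b k m
    by (simp add: algebra_simps)
  have "times_t A ** C = mat 1" "C ** times_t A = mat 1"
    using B unfolding vec_eq_iff matrix_matrix_mult_def times_t_def C_def mat_def
    by (simp_all only: vec_lambda_beta e tt mult_1_right of_int_sum[symmetric]) auto
  then show ?thesis unfolding invertible_def by blast
qed

lemma letter_matrix_flip: assumes "\<And>a. invertible (A a)"
  shows "letter_matrix A l ** letter_matrix A (flip l) = mat 1"
  using matrix_inv_inverse[OF invertible_times_t[OF assms]]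
  by (cases l) (auto simp: flip_def)

lemma foldr_letter_matrix_push: assumes "\<And>a. invertible (A a)"
  shows "foldr (\<lambda>l M. letter_matrix A l ** M) (push l w) (mat 1)
   = letter_matrix A l ** foldr (\<lambda>l M. letter_matrix A l ** M) w (mat 1)"
proof (cases w)
  case (Cons m w')
  show ?thesis unfolding Cons by (auto simp: matrix_mul_assoc letter_matrix_flip[OF assms])
qed simp

lemma element_matrix_add: assumes "\<And>a. invertible (A a)"
  shows "element_matrix A (u + v) = element_matrix A u ** element_matrix A v"
proof -
  have "foldr (\<lambda>l M. letter_matrix A l ** M) (foldr push x y) (mat 1) =
    foldr (\<lambda>l M. letter_matrix A l ** M) x (mat 1) ** foldr (\<lambda>l M. letter_matrix A l ** M) y (mat 1)" for x y
    by (induction x) (auto simp: foldr_letter_matrix_push[OF assms] matrix_mul_assoc)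
  then show ?thesis by (simp add: element_matrix_def plus_free_group.rep_eq)
qed

lemma poly_mapping_additive_induct: fixes p :: "'a \<Rightarrow>\<^sub>0 int"
  assumes "P 0" "\<And>k v. P (Poly_Mapping.single k v)" "\<And>p q. P p \<Longrightarrow> P q \<Longrightarrow> P (p + q)" shows "P p"
proof (induction p rule: update_induct)
  case const show ?case by (rule assms)
next
  case (update f a b)
  have "Poly_Mapping.update a b f = f + Poly_Mapping.single a b"
    using update(1) by (intro poly_mapping_eqI) (auto simp: lookup_update lookup_add lookup_single in_keys_iff when_def)
  then show ?case using assms update by simp
qed

lemma Phi_mult: assumes "\<And>a. invertible (A a)"
  shows "Phi A (p * q) = Phi A p ** Phi A q"
proof -
  have mc: "mat c ** M = M ** mat c" for c and M :: "laurent^'b^'b"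
    by (simp add: mat_def matrix_matrix_mult_def if_distrib if_distribR vec_eq_iff mult.commute cong: if_cong)
  have mm: "mat (a * b) = (mat a ** mat b :: laurent^'b^'b)" for a b
    by (simp add: mat_mult_left) (simp add: mat_def vec_eq_iff)
  have z: "Phi A 0 = 0" by (simp add: Phi_def)
  have ss: "Phi A (Poly_Mapping.single g c * Poly_Mapping.single h d) =
    Phi A (Poly_Mapping.single g c) ** Phi A (Poly_Mapping.single h d)" for g h c d
    unfolding mult_single Phi_single element_matrix_add[OF assms] of_int_mult mm
    by (metis mc matrix_mul_assoc)
  have s1: "Phi A (Poly_Mapping.single g c * q) = Phi A (Poly_Mapping.single g c) ** Phi A q" for g c
  proof (induction q rule: poly_mapping_additive_induct)
    case 1 show ?case by (simp add: z matrix_matrix_mult_def vec_eq_iff)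
  next
    case (2 k v) show ?case by (rule ss)
  next
    case (3 p q) then show ?case by (simp add: distrib_left Phi_add matrix_add_ldistrib)
  qed
  show ?thesis
  proof (induction p rule: poly_mapping_additive_induct)
    case 1 show ?case by (simp add: z matrix_matrix_mult_def vec_eq_iff)
  next
    case (2 k v) show ?case by (rule s1)
  next
    case (3 p q) then show ?case by (simp add: distrib_right Phi_add matrix_matrix_mult_def vec_eq_iff sum.distrib)
  qed
qed

definition twisted_alexander ::
  "(meridian \<Rightarrow> int^'n^'n) \<Rightarrow> meridian free_group \<Rightarrow> laurent fract" where
  "twisted_alexander A R =
     Fract (det (Phi A (fox MX R))) (det (Phi A (grp (gen MY) - 1)))"

definition eq_up_to_unit :: "laurent fract \<Rightarrow> laurent fract \<Rightarrow> bool" (infix "\<doteq>" 50) where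
  "f \<doteq> g \<longleftrightarrow> (\<exists>s k. s \<in> {1, -1} \<and> f = Fract (s * t_pow k) 1 * g)"

definition poly_in_t_pow :: "int poly \<Rightarrow> int \<Rightarrow> laurent" where
  "poly_in_t_pow \<phi> k = poly (map_poly of_int \<phi>) (t_pow k)"


section \<open>The representation of the alternating group on four letters\<close>

definition X_matrix :: "int^3^3" where
  "X_matrix = vector [vector [-1, 1, 0], vector [-1, 0, 0], vector [-1, 0, 1]]"

definition Y_matrix :: "int^3^3" where
  "Y_matrix = vector [vector [0, 0, -1], vector [0, 1, -1], vector [1, 0, -1]]"

text \<open>
  \<open>x\<close> goes to the permutation (123) and \<open>y\<close> to (142), followed by the irreducible integral
  representation of degree 3. Only the values on the two meridians are recorded; the relation
  \<open>xyx = yxy\<close>, that is \<open>R0 = 1\<close>, is \<open>rho0_braid\<close> below.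
\<close>

fun rho0 :: "meridian \<Rightarrow> int^3^3" where
  "rho0 MX = X_matrix"
| "rho0 MY = Y_matrix"

lemma rho0_braid: "X_matrix ** Y_matrix ** X_matrix = Y_matrix ** X_matrix ** Y_matrix"
  by (simp add: X_matrix_def Y_matrix_def matrix_matrix_mult_def vec_eq_iff forall_3 sum_3 vector_3)

lemma rho0_cube: "Y_matrix ** Y_matrix ** Y_matrix = mat 1" "X_matrix ** X_matrix ** X_matrix = mat 1"
  by (simp_all add: X_matrix_def Y_matrix_def matrix_matrix_mult_def vec_eq_iff forall_3 sum_3 vector_3 mat_def)

lemma invertible_rho0: "invertible (rho0 a)"
proof (cases a)
 case MX then show ?thesis using rho0_cube(2) unfolding invertible_def by (auto intro!: exI[of _ "X_matrix ** X_matrix"] simp: matrix_mul_assoc)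
next
 case MY then show ?thesis using rho0_cube(1) unfolding invertible_def by (auto intro!: exI[of _ "Y_matrix ** Y_matrix"] simp: matrix_mul_assoc)
qed

text \<open>The denominator of the twisted Alexander polynomial is nonzero.\<close>

lemma t_pow_3: "t_pow 3 = t_pow 1 * t_pow 1 * t_pow 1" by (simp add: mult_single)

lemma det_Phi_y_minus_1: "det (Phi rho0 (grp (gen MY) - 1)) = t_pow 3 - 1"
  by (simp add: t_pow_3 Phi_minus Phi_gen Phi_one det_3 times_t_def Y_matrix_def mat_def vector_3 algebra_simps del: Poly_Mapping.mult_single)

end

theory Submission
  imports Defs
begin

text \<open>
  Let \<open>D(t)\<close> be the determinant of the image of \<open>\<partial>R/\<partial>x\<close>. The denominator is \<open>t^3 - 1\<close>, so it is
  enough that \<open>D\<close> is a Laurent polynomial in \<open>t^3\<close> and that \<open>D(1) = 0\<close>: writing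
  \<open>D = t^(-3n) p(t^3)\<close> with an integer polynomial \<open>p\<close>, the second property says that \<open>p\<close> is divisible
  by the linear polynomial with root 1.

  The first property holds for every element of the group ring (\<open>det_Phi_cubic\<close>). Over the
  rationals, \<open>rho0\<close> is conjugate to a representation by signed permutation matrices in which the Klein
  four-group is diagonal and \<open>x\<close>, \<open>y\<close> permute the coordinates cyclically. Conjugating further by the
  diagonal matrix with entries \<open>t^2, t, 1\<close> turns \<open>X t\<close> and \<open>Y t\<close> into matrices whose entries lie in
  \<open>\<int>[t^3, t^(-3)]\<close>.

  The second property needs \<open>rho0(R) = 1\<close> (\<open>at_one_det_Phi_fox\<close>). Let \<open>A\<close> and \<open>B\<close> be the values at
  \<open>t = 1\<close> of the matrices of \<open>\<partial>R/\<partial>x\<close> and \<open>\<partial>R/\<partial>y\<close>. The fundamental formula of the Fox calculus gives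
  \<open>A (X - 1) + B (Y - 1) = 0\<close>. Applied to a fixed vector \<open>v\<close> of \<open>Y\<close>, it gives \<open>A (X v - v) = 0\<close>,
  and \<open>X v \<noteq> v\<close>, so \<open>A\<close> is singular.

  Finally \<open>rho0(R) = 1\<close> for every knot in \<open>H(3)\<close> (\<open>rho0_two_bridge_R\<close>). The free product
  \<open>\<int>/2 * \<int>/3\<close> maps onto the alternating group on four letters, so the knot group does too. The
  images \<open>U\<close>, \<open>V\<close> of the meridians are conjugate by the form of \<open>R\<close>, and they do not commute, because
  they generate a non-abelian group. Any two conjugate non-commuting elements of this group are
  3-cycles carried to \<open>(123)\<close> and \<open>(142)\<close> by an automorphism; in matrices, some \<open>Q\<close> with nonzero
  determinant satisfies \<open>U Q = Q X\<close> and \<open>V Q = Q Y\<close> (\<open>tetrahedral_intertwiner\<close>). Hence the relation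
  \<open>R(U, V) = 1\<close> implies \<open>R(X, Y) = 1\<close>.
\<close>

(* The dollar sign is also notation for coefficients of power series, which makes terms ambiguous. *)
no_notation fps_nth (infixl \<open>$\<close> 75)

section \<open>Explicit three-by-three matrices\<close>

text \<open>The matrix with the given entries, row by row; it is kept folded so that products are computed
  by rewriting.\<close>

definition mat3 :: "'a::zero \<Rightarrow> 'a \<Rightarrow> 'a \<Rightarrow> 'a \<Rightarrow> 'a \<Rightarrow> 'a \<Rightarrow> 'a \<Rightarrow> 'a \<Rightarrow> 'a \<Rightarrow> 'a^3^3" where
  "mat3 a b c d e f g h i = vector [vector [a, b, c], vector [d, e, f], vector [g, h, i]]"

lemma mat3_nth [simp]:
  "mat3 a b c d e f g h i $ 1 $ 1 = a" "mat3 a b c d e f g h i $ 1 $ 2 = b" "mat3 a b c d e f g h i $ 1 $ 3 = c"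
  "mat3 a b c d e f g h i $ 2 $ 1 = d" "mat3 a b c d e f g h i $ 2 $ 2 = e" "mat3 a b c d e f g h i $ 2 $ 3 = f"
  "mat3 a b c d e f g h i $ 3 $ 1 = g" "mat3 a b c d e f g h i $ 3 $ 2 = h" "mat3 a b c d e f g h i $ 3 $ 3 = i"
  by (simp_all add: mat3_def vector_3)

lemma mat3_mult:
  fixes a :: "'a::semiring_1"
  shows "mat3 a b c d e f g h i ** mat3 p q r s t u v w x =
    mat3 (a * p + b * s + c * v) (a * q + b * t + c * w) (a * r + b * u + c * x)
         (d * p + e * s + f * v) (d * q + e * t + f * w) (d * r + e * u + f * x)
         (g * p + h * s + i * v) (g * q + h * t + i * w) (g * r + h * u + i * x)"
  by (simp add: vec_eq_iff forall_3 matrix_matrix_mult_def sum_3)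

lemma mat3_eq_iff:
  "mat3 a b c d e f g h i = mat3 p q r s t u v w x \<longleftrightarrow>
    a = p \<and> b = q \<and> c = r \<and> d = s \<and> e = t \<and> f = u \<and> g = v \<and> h = w \<and> i = x"
  by (auto simp: vec_eq_iff forall_3)

lemma transpose_mat3: "transpose (mat3 a b c d e f g h i) = mat3 a d g b e h c f i"
  by (simp add: vec_eq_iff forall_3 transpose_def)

lemma mat_1_mat3: "(mat 1 :: 'a::zero_neq_one^3^3) = mat3 1 0 0 0 1 0 0 0 1"
  by (simp add: vec_eq_iff forall_3 mat_def)

lemma det_mat3:
  "det (mat3 a b c d e f g h i :: 'a::comm_ring_1^3^3) =
    a * e * i + b * f * g + c * d * h - a * f * h - b * d * i - c * e * g"
  by (simp add: det_3)

lemma X_matrix_mat3: "X_matrix = mat3 (-1) 1 0 (-1) 0 0 (-1) 0 1"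
  by (simp add: X_matrix_def mat3_def)

lemma Y_matrix_mat3: "Y_matrix = mat3 0 0 (-1) 0 1 (-1) 1 0 (-1)"
  by (simp add: Y_matrix_def mat3_def)

lemmas mat3_simps = mat3_mult mat3_eq_iff transpose_mat3 mat_1_mat3

lemma kernel_trivial_3:
  fixes a b c d e f g h i x y z :: "'a::idom"
  assumes "a * e * i + b * f * g + c * d * h - a * f * h - b * d * i - c * e * g \<noteq> 0" (is "?D \<noteq> 0")
    and "a * x + b * y + c * z = 0" (is "?p = 0")
    and "d * x + e * y + f * z = 0" (is "?q = 0")
    and "g * x + h * y + i * z = 0" (is "?r = 0")
  shows "x = 0 \<and> y = 0 \<and> z = 0"
proof -
  have "?D * x = (e * i - f * h) * ?p - (b * i - c * h) * ?q + (b * f - c * e) * ?r"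
    by (simp add: algebra_simps)
  moreover have "?D * y = - (d * i - f * g) * ?p + (a * i - c * g) * ?q - (a * f - c * d) * ?r"
    by (simp add: algebra_simps)
  moreover have "?D * z = (d * h - e * g) * ?p - (a * h - b * g) * ?q + (a * e - b * d) * ?r"
    by (simp add: algebra_simps)
  ultimately have "?D * x = 0" "?D * y = 0" "?D * z = 0"
    using assms(2-4) by simp_all
  then show ?thesis using assms(1) by simp
qed

lemma matrix_mult_left_cancel_3:
  fixes Q M :: "'a::idom^3^3"
  assumes "Q ** M = Q" "det Q \<noteq> 0"
  shows "M = mat 1"
proof -
  define N where "N = M - mat 1"
  have "Q ** N = 0"
    using assms(1) matrix_add_ldistrib[of Q N "mat 1"] by (simp add: N_def)
  then have "Q$k$1 * N$1$j + Q$k$2 * N$2$j + Q$k$3 * N$3$j = 0" for k j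
    by (simp add: vec_eq_iff matrix_matrix_mult_def sum_3)
  then have "N$1$j = 0 \<and> N$2$j = 0 \<and> N$3$j = 0" for j
    using assms(2) unfolding det_3 by (intro kernel_trivial_3)
  then show ?thesis by (simp add: N_def vec_eq_iff forall_3)
qed


section \<open>Words in a free group\<close>

lemma free_group_induct [case_names zero letter]:
  assumes "P 0" and "\<And>l g. P g \<Longrightarrow> P (of_letter l + g)"
  shows "P (g :: 'a free_group)"
proof -
  have "P (Abs_free_group w)" if "freely_reduced w" for w
    using that
  proof (induction w)
    case Nil
    then show ?case using assms(1) by (simp add: zero_free_group_def)
  next
    case (Cons l w)
    have r: "freely_reduced w" using Cons.prems reduced_tl by blast
    have "word (of_letter l + Abs_free_group w) = l # w"
      using Cons.prems r
      by (simp add: plus_free_group.rep_eq of_letter.rep_eq Abs_free_group_inverse push_reduced)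
    then have "Abs_free_group (l # w) = of_letter l + Abs_free_group w"
      using word_inverse by metis
    then show ?case using assms(2) Cons.IH r by simp
  qed
  from this[of "word g"] show ?thesis using word[of g] by (simp add: word_inverse)
qed

lemma fox_zero: "fox a 0 = 0"
  by (simp add: fox_def zero_free_group.rep_eq)

text \<open>The fundamental formula of the Fox calculus.\<close>

lemma fox_fundamental:
  "fox MX g * (grp (gen MX) - 1) + fox MY g * (grp (gen MY) - 1) = grp g - 1"
proof (induction g rule: free_group_induct)
  case zero
  then show ?case by (simp add: fox_zero)
next
  case (letter l g)
  have letter: "fox MX (of_letter l) * (grp (gen MX) - 1) + fox MY (of_letter l) * (grp (gen MY) - 1)
      = grp (of_letter l) - 1"
  proof (cases l)
    case (Pair a e)
    have "of_letter (a, False) + gen a = 0"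
      by (simp add: uminus_gen[symmetric])
    then show ?thesis
      using Pair by (cases a; cases e)
        (simp_all add: fox_def of_letter.rep_eq right_diff_distrib mult_single)
  qed
  have "fox MX (of_letter l + g) * (grp (gen MX) - 1) + fox MY (of_letter l + g) * (grp (gen MY) - 1) =
    (fox MX (of_letter l) * (grp (gen MX) - 1) + fox MY (of_letter l) * (grp (gen MY) - 1)) +
    grp (of_letter l) * (fox MX g * (grp (gen MX) - 1) + fox MY g * (grp (gen MY) - 1))"
    by (simp add: fox_add algebra_simps del: mult_single)
  also have "\<dots> = grp (of_letter l + g) - 1"
    unfolding letter letter.IH by (simp add: right_diff_distrib mult_single)
  finally show ?case .
qed


section \<open>Homomorphisms from presented groups\<close>

lemma full_free_group_simps [simp]:
  "carrier full_free_group = UNIV" "mult full_free_group = (+)" "one full_free_group = 0"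
  by (simp_all add: full_free_group_def)

lemma free_group_on_simps [simp]:
  "carrier (free_group_on S) = generate full_free_group (gen ` S)"
  "mult (free_group_on S) = (+)" "one (free_group_on S) = 0"
  by (simp_all add: free_group_on_def full_free_group_def)

lemma inv_full_free_group [simp]: "inv\<^bsub>full_free_group\<^esub> g = - g"
  by (rule group.inv_equality[OF group_full_free_group]) simp_all

lemma uminus_in_free_group_on:
  "g \<in> carrier (free_group_on S) \<Longrightarrow> - g \<in> carrier (free_group_on S)"
  using group.generate_m_inv_closed[OF group_full_free_group, of "gen ` S" g] by simp

lemma inv_free_group_on [simp]:
  "g \<in> carrier (free_group_on S) \<Longrightarrow> inv\<^bsub>free_group_on S\<^esub> g = - g"
  using uminus_in_free_group_on[of g S]
  by (intro group.inv_equality[OF group_free_group_on]) simp_all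

lemma gen_in_free_group_on: "a \<in> S \<Longrightarrow> gen a \<in> carrier (free_group_on S)"
  by (simp add: generate.incl)

lemma plus_in_free_group_on:
  "g \<in> carrier (free_group_on S) \<Longrightarrow> h \<in> carrier (free_group_on S) \<Longrightarrow>
    g + h \<in> carrier (free_group_on S)"
  using generate.eng[of g full_free_group "gen ` S" h] by simp

lemma carrier_free_group_on_UNIV: "carrier (free_group_on UNIV) = UNIV"
proof -
  have "g \<in> carrier (free_group_on UNIV)" for g :: "'a free_group"
  proof (induction g rule: free_group_induct)
    case zero
    then show ?case using generate.one[of full_free_group] by simp
  next
    case (letter l g)
    have "of_letter l \<in> carrier (free_group_on UNIV)"
    proof (cases l)
      case (Pair a e)
      have "gen a \<in> carrier (free_group_on UNIV)" by (rule gen_in_free_group_on) simp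
      then show ?thesis
        using uminus_in_free_group_on[of "gen a" UNIV] Pair by (cases e) (simp_all add: uminus_gen)
    qed
    then show ?case using letter by (rule plus_in_free_group_on)
  qed
  then show ?thesis by blast
qed

lemma (in group) normal_closure_normal:
  assumes "R \<subseteq> carrier G"
  shows "normal_closure G R \<lhd> G"
  unfolding normal_closure_def
proof (rule normal_generateI)
  show "{g \<otimes> r \<otimes> inv g | g r. g \<in> carrier G \<and> r \<in> R} \<subseteq> carrier G"
    using assms by auto
next
  fix h k
  assume "h \<in> {g \<otimes> r \<otimes> inv g | g r. g \<in> carrier G \<and> r \<in> R}" and k: "k \<in> carrier G"
  then obtain g r where gr: "g \<in> carrier G" "r \<in> R" "h = g \<otimes> r \<otimes> inv g" by blast
  then have "r \<in> carrier G" using assms by blast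
  then have "k \<otimes> h \<otimes> inv k = (k \<otimes> g) \<otimes> r \<otimes> inv (k \<otimes> g)"
    using gr k by (simp add: inv_mult_group m_assoc)
  then show "k \<otimes> h \<otimes> inv k \<in> {g \<otimes> r \<otimes> inv g | g r. g \<in> carrier G \<and> r \<in> R}"
    using gr k by blast
qed

lemma (in group) normal_closure_incl:
  assumes "R \<subseteq> carrier G" "r \<in> R"
  shows "r \<in> normal_closure G R"
proof -
  have "r = \<one> \<otimes> r \<otimes> inv \<one>" using assms by auto
  then show ?thesis
    unfolding normal_closure_def using assms(2) by (blast intro: generate.incl)
qed

lemma (in group_hom) normal_closure_subset_kernel:
  assumes "R \<subseteq> carrier G" "\<And>r. r \<in> R \<Longrightarrow> h r = \<one>\<^bsub>H\<^esub>"
  shows "normal_closure G R \<subseteq> kernel G H h"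
  unfolding normal_closure_def
proof (rule G.generate_subgroup_incl[OF _ subgroup_kernel])
  show "{g \<otimes>\<^bsub>G\<^esub> r \<otimes>\<^bsub>G\<^esub> inv\<^bsub>G\<^esub> g | g r. g \<in> carrier G \<and> r \<in> R} \<subseteq> kernel G H h"
    using assms unfolding kernel_def by auto
qed

text \<open>The existence part of the universal property of a presentation.\<close>

lemma presented_group_universal:
  assumes "group H" "f \<in> hom full_free_group H"
    and R: "R \<subseteq> carrier (free_group_on S)" "\<And>r. r \<in> R \<Longrightarrow> f r = \<one>\<^bsub>H\<^esub>"
  obtains \<psi> where "\<psi> \<in> hom (presented_group S R) H"
    "\<And>g. g \<in> carrier (free_group_on S) \<Longrightarrow>
       \<psi> (normal_closure (free_group_on S) R #>\<^bsub>free_group_on S\<^esub> g) = f g"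
proof -
  have "f \<in> hom (free_group_on S) H"
    using assms(2) by (auto simp: hom_def)
  then interpret group_hom "free_group_on S" H f
    using assms(1) group_free_group_on by (simp add: group_hom_def group_hom_axioms_def)
  show ?thesis
    using FactGroup_universal_kernel[OF G.normal_closure_normal[OF R(1)]
        normal_closure_subset_kernel[OF R]] that
    unfolding presented_group_def by blast
qed


section \<open>Evaluation at one\<close>

text \<open>The value of a Laurent polynomial at \<open>t = 1\<close>, which is the sum of its coefficients.\<close>

definition at_one :: "laurent \<Rightarrow> int" where
  "at_one p = (\<Sum>k\<in>Poly_Mapping.keys p. Poly_Mapping.lookup p k)"

lemma at_one_superset:
  assumes "finite S" "Poly_Mapping.keys p \<subseteq> S"
  shows "at_one p = (\<Sum>k\<in>S. Poly_Mapping.lookup p k)"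
  unfolding at_one_def using assms
  by (intro sum.mono_neutral_left) (auto simp: in_keys_iff)

lemma at_one_add: "at_one (p + q) = at_one p + at_one q"
proof -
  let ?S = "Poly_Mapping.keys p \<union> Poly_Mapping.keys q"
  have "at_one (p + q) = (\<Sum>k\<in>?S. Poly_Mapping.lookup (p + q) k)"
    using Poly_Mapping.keys_add[of p q] by (intro at_one_superset) auto
  also have "\<dots> = (\<Sum>k\<in>?S. Poly_Mapping.lookup p k) + (\<Sum>k\<in>?S. Poly_Mapping.lookup q k)"
    by (simp add: lookup_add sum.distrib)
  also have "\<dots> = at_one p + at_one q"
    by (subst (1 2) at_one_superset[of ?S]) auto
  finally show ?thesis .
qed

lemma at_one_single [simp]: "at_one (Poly_Mapping.single k c) = c"
  by (cases "c = 0") (auto simp: at_one_def)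

lemma at_one_0 [simp]: "at_one 0 = 0" and at_one_1 [simp]: "at_one 1 = 1"
  by (simp add: at_one_def, metis at_one_single single_one)

lemma at_one_diff: "at_one (p - q) = at_one p - at_one q"
  using at_one_add[of "p - q" q] by simp

lemma at_one_mult: "at_one (p * q) = at_one p * at_one q"
proof (induction p rule: poly_mapping_additive_induct)
  case (2 k v)
  show ?case
    by (induction q rule: poly_mapping_additive_induct)
      (simp_all add: mult_single distrib_left at_one_add)
qed (simp_all add: distrib_right at_one_add)

lemma at_one_sum: "at_one (sum f K) = (\<Sum>k\<in>K. at_one (f k))"
  by (induction K rule: infinite_finite_induct) (simp_all add: at_one_add)

lemma at_one_of_int: "at_one (of_int n) = n"
proof -
  have "at_one (of_nat m) = int m" for m by (induction m) (simp_all add: at_one_add)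
  moreover have "at_one (- p) = - at_one p" for p
    using at_one_diff[of 0 p] by simp
  ultimately show ?thesis by (cases n rule: int_cases2) simp_all
qed

lemma at_one_numeral [simp]: "at_one (numeral n) = numeral n"
  using at_one_of_int[of "numeral n"] by simp

text \<open>Entrywise evaluation at \<open>t = 1\<close>.\<close>

definition map_at_one :: "laurent^'n^'n \<Rightarrow> int^'n^'n" where
  "map_at_one M = (\<chi> i j. at_one (M $ i $ j))"

lemma map_at_one_mult: "map_at_one (M ** N) = map_at_one M ** map_at_one N"
  by (simp add: map_at_one_def matrix_matrix_mult_def vec_eq_iff at_one_mult at_one_sum)

lemma map_at_one_add: "map_at_one (M + N) = map_at_one M + map_at_one N"
  and map_at_one_diff: "map_at_one (M - N) = map_at_one M - map_at_one N"
  by (simp_all add: map_at_one_def vec_eq_iff at_one_add at_one_diff)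

lemma map_at_one_1: "map_at_one (mat 1) = mat 1"
  by (simp add: map_at_one_def mat_def vec_eq_iff)

lemma map_at_one_times_t: "map_at_one (times_t A) = A"
  by (simp add: map_at_one_def times_t_def vec_eq_iff at_one_mult at_one_of_int)

lemma det_map_at_one: "det (map_at_one M) = at_one (det (M :: laurent^3^3))"
  by (simp add: det_3 map_at_one_def at_one_add at_one_diff at_one_mult)

text \<open>
  For matrices \<open>A a\<close> that are invertible over the integers, the integral representation of the free
  group that sends each generator \<open>a\<close> to \<open>A a\<close>. It is obtained by setting \<open>t = 1\<close> in the representation over the Laurent polynomials.
\<close>

definition eval_rep :: "('a \<Rightarrow> int^'n^'n) \<Rightarrow> 'a free_group \<Rightarrow> int^'n^'n" where
  "eval_rep A g = map_at_one (element_matrix A g)"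

lemma eval_rep_zero: "eval_rep A 0 = mat 1"
  by (simp add: eval_rep_def element_matrix_def zero_free_group.rep_eq map_at_one_1)

lemma eval_rep_gen: "eval_rep A (gen a) = A a"
  by (simp add: eval_rep_def element_matrix_def of_letter.rep_eq map_at_one_times_t)

lemma eval_rep_add:
  assumes "\<And>a. invertible (A a)"
  shows "eval_rep A (g + h) = eval_rep A g ** eval_rep A h"
  by (simp add: eval_rep_def element_matrix_add[OF assms] map_at_one_mult)

text \<open>The homomorphisms from the free group to integral matrices.\<close>

definition matrix_rep :: "('a free_group \<Rightarrow> int^'n^'n) \<Rightarrow> bool" where
  "matrix_rep f \<longleftrightarrow> f 0 = mat 1 \<and> (\<forall>g h. f (g + h) = f g ** f h)"

lemma matrix_rep_zero: "matrix_rep f \<Longrightarrow> f 0 = mat 1"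
  and matrix_rep_add: "matrix_rep f \<Longrightarrow> f (g + h) = f g ** f h"
  by (simp_all add: matrix_rep_def)

lemma matrix_rep_inverse:
  assumes "matrix_rep f"
  shows "f g ** f (- g) = mat 1" "f (- g) ** f g = mat 1"
  using matrix_rep_add[OF assms, of g "- g"] matrix_rep_add[OF assms, of "- g" g]
  by (simp_all add: matrix_rep_zero[OF assms])

lemma matrix_rep_eval_rep:
  assumes "\<And>a. invertible (A a)"
  shows "matrix_rep (eval_rep A)"
  unfolding matrix_rep_def by (simp add: eval_rep_zero eval_rep_add[OF assms])

lemma matrix_rep_intertwine:
  assumes f: "matrix_rep f" and f': "matrix_rep f'"
    and gen: "\<And>a. f (gen a) ** Q = Q ** f' (gen a)"
  shows "f g ** Q = Q ** f' g"
proof (induction g rule: free_group_induct)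
  case zero
  then show ?case using f f' by (simp add: matrix_rep_zero)
next
  case (letter l g)
  have "f (of_letter l) ** Q = Q ** f' (of_letter l)"
  proof (cases l)
    case (Pair a e)
    show ?thesis
    proof (cases e)
      case True
      then show ?thesis using gen Pair by simp
    next
      case False
      have "f (- gen a) ** Q = f (- gen a) ** (Q ** (f' (gen a) ** f' (- gen a)))"
        by (simp only: matrix_rep_inverse[OF f'] matrix_mul_rid)
      also have "\<dots> = f (- gen a) ** (f (gen a) ** Q ** f' (- gen a))"
        by (simp only: gen matrix_mul_assoc)
      also have "\<dots> = (f (- gen a) ** f (gen a)) ** (Q ** f' (- gen a))"
        by (simp only: matrix_mul_assoc)
      also have "\<dots> = Q ** f' (- gen a)"
        by (simp only: matrix_rep_inverse[OF f] matrix_mul_lid)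
      finally show ?thesis
        using Pair False by (simp add: uminus_gen)
    qed
  qed
  then have "f (of_letter l) ** (f g ** Q) = Q ** f' (of_letter l) ** f' g"
    unfolding letter by (simp add: matrix_mul_assoc)
  then show ?case
    by (simp add: matrix_rep_add[OF f] matrix_rep_add[OF f'] matrix_mul_assoc)
qed


section \<open>The rotation group of the tetrahedron\<close>

text \<open>
  The rotations of a regular tetrahedron whose vertices are alternate vertices of a cube, as signed
  permutation matrices: the Klein four-group of diagonal matrices and its two other cosets. The group
  is isomorphic to the alternating group on four letters, and inverses are transposes.
\<close>

definition tetrahedral :: "(int^3^3) set" where
  "tetrahedral = {
     mat3 1 0 0 0 1 0 0 0 1, mat3 1 0 0 0 (-1) 0 0 0 (-1),
     mat3 (-1) 0 0 0 1 0 0 0 (-1), mat3 (-1) 0 0 0 (-1) 0 0 0 1,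
     mat3 0 0 1 1 0 0 0 1 0, mat3 0 0 (-1) 1 0 0 0 (-1) 0,
     mat3 0 0 (-1) (-1) 0 0 0 1 0, mat3 0 0 1 (-1) 0 0 0 (-1) 0,
     mat3 0 1 0 0 0 1 1 0 0, mat3 0 (-1) 0 0 0 (-1) 1 0 0,
     mat3 0 1 0 0 0 (-1) (-1) 0 0, mat3 0 (-1) 0 0 0 1 (-1) 0 0}"

lemma tetrahedral_mult: "A \<in> tetrahedral \<Longrightarrow> B \<in> tetrahedral \<Longrightarrow> A ** B \<in> tetrahedral"
proof -
  have "\<forall>A\<in>tetrahedral. \<forall>B\<in>tetrahedral. A ** B \<in> tetrahedral"
    unfolding tetrahedral_def by (simp add: mat3_simps)
  then show "A \<in> tetrahedral \<Longrightarrow> B \<in> tetrahedral \<Longrightarrow> A ** B \<in> tetrahedral" by blast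
qed

lemma tetrahedral_transpose:
  "A \<in> tetrahedral \<Longrightarrow> transpose A \<in> tetrahedral \<and> transpose A ** A = mat 1 \<and> A ** transpose A = mat 1"
  unfolding tetrahedral_def by (auto simp: mat3_simps)

definition tetrahedral_group :: "(int^3^3) monoid" where
  "tetrahedral_group = \<lparr>carrier = tetrahedral, mult = (**), one = mat 1\<rparr>"

lemma group_tetrahedral_group: "group tetrahedral_group"
proof (rule groupI)
  show "\<one>\<^bsub>tetrahedral_group\<^esub> \<in> carrier tetrahedral_group"
    by (simp add: tetrahedral_group_def tetrahedral_def mat_1_mat3)
qed (use tetrahedral_mult tetrahedral_transpose in
    \<open>auto simp: tetrahedral_group_def matrix_mul_assoc\<close>)

text \<open>
  The representation \<open>rho0\<close> permutes four vectors with sum zero: the fixed vector \<open>e\<^sub>2\<close> of \<open>Y\<close>, then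
  \<open>e\<^sub>1 = X e\<^sub>2\<close> and \<open>X^2 e\<^sub>2\<close>, and \<open>e\<^sub>3\<close>, which is fixed by \<open>X\<close>. The intertwining matrix therefore has the
  columns \<open>U w\<close>, \<open>w\<close> and \<open>- (w + U w + U^2 w)\<close>, where \<open>w\<close> is a fixed vector of \<open>V\<close>. For \<open>V\<close> of order 3,
  summing the orbit of the vector with entries \<open>1, 2, 4\<close> gives a fixed vector; it is nonzero for each
  of the four rotation axes because no signed sum of 1, 2 and 4 vanishes. In the definition, \<open>W\<close> has
  \<open>w\<close> as its second column, and the elementary matrices on the right move that column.
\<close>

definition intertwiner :: "int^3^3 \<Rightarrow> int^3^3 \<Rightarrow> int^3^3" where
  "intertwiner U V = (let W = (mat 1 + V + V ** V) ** mat3 0 1 0 0 2 0 0 4 0 in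
     U ** W ** mat3 0 0 0 1 0 0 0 0 0 + W - (mat 1 + U + U ** U) ** W ** mat3 0 0 0 0 0 1 0 0 0)"

lemma Let_mat3: "Let (mat3 a b c d e f g h i) F = F (mat3 a b c d e f g h i)"
  by (simp add: Let_def)

lemma mat3_add: "mat3 a b c d e f g h i + mat3 p q r s t u v w x =
    mat3 (a + p) (b + q) (c + r) (d + s) (e + t) (f + u) (g + v) (h + w) (i + x :: 'a::monoid_add)"
  by (simp add: vec_eq_iff forall_3)

lemma mat3_diff: "mat3 a b c d e f g h i - mat3 p q r s t u v w x =
    mat3 (a - p) (b - q) (c - r) (d - s) (e - t) (f - u) (g - v) (h - w) (i - x :: 'a::group_add)"
  by (simp add: vec_eq_iff forall_3)

text \<open>
  Conjugate non-commuting elements of the group have order 3. There are 72 choices of \<open>U\<close> and \<open>G\<close> to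
  consider, and each is checked by calculation.
\<close>

lemma tetrahedral_intertwiner:
  assumes "U \<in> tetrahedral" "G \<in> tetrahedral" "V = G ** U ** transpose G" "U ** V \<noteq> V ** U"
  shows "det (intertwiner U V) \<noteq> 0 \<and> U ** intertwiner U V = intertwiner U V ** X_matrix \<and> 
     V ** intertwiner U V = intertwiner U V ** Y_matrix"
proof -
  have "\<forall>U\<in>tetrahedral. \<forall>G\<in>tetrahedral. let V = G ** U ** transpose G in U ** V \<noteq> V ** U \<longrightarrow>
     (let Q = intertwiner U V in
       det Q \<noteq> 0 \<and> U ** Q = Q ** X_matrix \<and> V ** Q = Q ** Y_matrix)"
    unfolding tetrahedral_def intertwiner_def
    by (simp add: mat3_simps mat3_add mat3_diff det_mat3 X_matrix_mat3 Y_matrix_mat3 Let_mat3)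
  then show ?thesis using assms unfolding Let_def by blast
qed


section \<open>From the modular group to the tetrahedral group\<close>

text \<open>
  The images of the elements of the two factors: the generator of \<open>\<int>/2\<close> goes to a half-turn, the
  generator of \<open>\<int>/3\<close> to a rotation of order 3. Integers that are not representatives of residues go
  to the identity.
\<close>

fun factor_matrix :: "int + int \<Rightarrow> int^3^3" where
  "factor_matrix (Inl k) = (if k = 1 then mat3 1 0 0 0 (-1) 0 0 0 (-1) else mat 1)"
| "factor_matrix (Inr k) =
    (if k = 1 then mat3 0 0 1 1 0 0 0 1 0 else if k = 2 then mat3 0 1 0 0 0 1 1 0 0 else mat 1)"

lemma factor_matrix_tetrahedral: "factor_matrix a \<in> tetrahedral"
  by (cases a) (simp_all add: tetrahedral_def mat_1_mat3)

lemma invertible_factor_matrix: "invertible (factor_matrix a)"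
  using tetrahedral_transpose[OF factor_matrix_tetrahedral] unfolding invertible_def by blast

lemma matrix_rep_uminus_tetrahedral:
  assumes f: "matrix_rep f" and g: "f g \<in> tetrahedral"
  shows "f (- g) = transpose (f g)"
proof -
  have "f (- g) = transpose (f g) ** f g ** f (- g)"
    using tetrahedral_transpose[OF g] by (simp only: matrix_mul_lid)
  also have "\<dots> = transpose (f g)"
    by (simp only: matrix_mul_assoc[symmetric] matrix_rep_inverse[OF f] matrix_mul_rid)
  finally show ?thesis .
qed

lemma matrix_rep_tetrahedral:
  assumes f: "matrix_rep f" and gen: "\<And>a. f (gen a) \<in> tetrahedral"
  shows "f g \<in> tetrahedral"
proof (induction g rule: free_group_induct)
  case zero
  then show ?case by (simp add: matrix_rep_zero[OF f] tetrahedral_def mat_1_mat3)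
next
  case (letter l g)
  have "f (of_letter l) \<in> tetrahedral"
  proof (cases l)
    case (Pair a e)
    have "f (- gen a) \<in> tetrahedral"
      using tetrahedral_transpose[OF gen] by (simp add: matrix_rep_uminus_tetrahedral[OF f gen])
    then show ?thesis using gen Pair by (cases e) (simp_all add: uminus_gen)
  qed
  then show ?case using letter by (simp add: matrix_rep_add[OF f] tetrahedral_mult)
qed

text \<open>The image contains a half-turn and a rotation of order 3 that do not commute.\<close>

lemma modular_group_to_tetrahedral:
  fixes P defines "P \<equiv> free_product (integer_mod_group 2) (integer_mod_group 3)"
  obtains \<psi> a b where "\<psi> \<in> hom P tetrahedral_group" "a \<in> carrier P" "b \<in> carrier P"
    "\<psi> a ** \<psi> b \<noteq> \<psi> b ** \<psi> a"
proof -
  define S :: "(int + int) set" where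
    "S = Inl ` carrier (integer_mod_group 2) \<union> Inr ` carrier (integer_mod_group 3)"
  define R :: "(int + int) free_group set" where "R =
    {gen (Inl a) + gen (Inl b) - gen (Inl (a \<otimes>\<^bsub>integer_mod_group 2\<^esub> b)) | a b.
      a \<in> carrier (integer_mod_group 2) \<and> b \<in> carrier (integer_mod_group 2)} \<union>
    {gen (Inr a) + gen (Inr b) - gen (Inr (a \<otimes>\<^bsub>integer_mod_group 3\<^esub> b)) | a b.
      a \<in> carrier (integer_mod_group 3) \<and> b \<in> carrier (integer_mod_group 3)}"
  have P: "P = presented_group S R"
    unfolding P_def free_product_def S_def R_def ..
  define F where "F = free_group_on S"
  define N where "N = normal_closure F R"
  let ?f = "eval_rep factor_matrix"
  have rep: "matrix_rep ?f"
    by (rule matrix_rep_eval_rep) (rule invertible_factor_matrix)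
  have "?f g \<in> tetrahedral" for g
    using matrix_rep_tetrahedral[OF rep] by (simp add: eval_rep_gen factor_matrix_tetrahedral)
  then have f_hom: "?f \<in> hom full_free_group tetrahedral_group"
    by (simp add: hom_def tetrahedral_group_def matrix_rep_add[OF rep])
  have two: "k = 0 \<or> k = 1" if "k \<in> carrier (integer_mod_group 2)" for k
    using that by (auto simp: carrier_integer_mod_group)
  have three: "k = 0 \<or> k = 1 \<or> k = 2" if "k \<in> carrier (integer_mod_group 3)" for k
    using that by (auto simp: carrier_integer_mod_group)
  have kills: "?f (u + v - w) = mat 1" if "?f u ** ?f v = ?f w" for u v w
  proof -
    have "?f (u + v - w) = ?f u ** ?f v ** ?f (- w)"
      using matrix_rep_add[OF rep, of "u + v" "- w"] by (simp add: matrix_rep_add[OF rep])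
    then show ?thesis using that matrix_rep_inverse[OF rep] by simp
  qed
  have "?f (gen (Inl i) + gen (Inl j) - gen (Inl (i \<otimes>\<^bsub>integer_mod_group 2\<^esub> j))) = mat 1"
    if "i \<in> carrier (integer_mod_group 2)" "j \<in> carrier (integer_mod_group 2)" for i j
    by (rule kills) (use two[OF that(1)] two[OF that(2)] in \<open>auto simp: eval_rep_gen mat3_simps\<close>)
  moreover have "?f (gen (Inr i) + gen (Inr j) - gen (Inr (i \<otimes>\<^bsub>integer_mod_group 3\<^esub> j))) = mat 1"
    if "i \<in> carrier (integer_mod_group 3)" "j \<in> carrier (integer_mod_group 3)" for i j
    by (rule kills) (use three[OF that(1)] three[OF that(2)] in \<open>auto simp: eval_rep_gen mat3_simps\<close>)
  ultimately have R_one: "?f r = \<one>\<^bsub>tetrahedral_group\<^esub>" if "r \<in> R" for r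
    using that unfolding R_def by (simp only: tetrahedral_group_def monoid.simps) blast
  have relator: "gen u + gen v - gen w \<in> carrier F" if "u \<in> S" "v \<in> S" "w \<in> S" for u v w
  proof -
    have "gen u + gen v + - gen w \<in> carrier F"
      unfolding F_def using that
      by (intro plus_in_free_group_on uminus_in_free_group_on gen_in_free_group_on)
    then show ?thesis by simp
  qed
  have R_sub: "R \<subseteq> carrier F"
    unfolding R_def
    by (auto intro!: relator simp: S_def monoid.m_closed[OF group.is_monoid] simp del: mult_integer_mod_group)
  obtain \<psi> where \<psi>: "\<psi> \<in> hom P tetrahedral_group"
    "\<And>g. g \<in> carrier F \<Longrightarrow> \<psi> (N #>\<^bsub>F\<^esub> g) = ?f g"
    using presented_group_universal[OF group_tetrahedral_group f_hom, of R S] R_sub R_one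
    unfolding P N_def F_def by blast
  interpret normal N F
    unfolding N_def F_def by (rule group.normal_closure_normal[OF group_free_group_on R_sub[unfolded F_def]])
  have coset: "N #>\<^bsub>F\<^esub> g \<in> carrier P" if "g \<in> carrier F" for g
    using hom_in_carrier[OF r_coset_hom_Mod that] unfolding P presented_group_def N_def F_def .
  have gens: "gen (Inl 1) \<in> carrier F" "gen (Inr 1) \<in> carrier F"
    unfolding F_def by (rule gen_in_free_group_on, simp add: S_def carrier_integer_mod_group)+
  show ?thesis
    by (rule that[OF \<psi>(1) coset[OF gens(1)] coset[OF gens(2)]])
      (simp add: \<psi>(2) gens eval_rep_gen mat3_simps)
qed

text \<open>
  Of the word \<open>W\<close> only the form \<open>R = W x W\<^sup>-\<^sup>1 y\<^sup>-\<^sup>1\<close> matters: it makes the images of the two meridians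
  conjugate.
\<close>

lemma rho0_two_bridge_R:
  assumes "in_H3 \<alpha> \<beta>"
  shows "eval_rep rho0 (two_bridge_R \<alpha> \<beta>) = mat 1"
proof -
  let ?F = "free_group_on (UNIV :: meridian set)"
  let ?R = "two_bridge_R \<alpha> \<beta>"
  define N where "N = normal_closure ?F {?R}"
  obtain \<phi> where \<phi>: "\<phi> \<in> epi (?F Mod N) (free_product (integer_mod_group 2) (integer_mod_group 3))"
    using assms unfolding in_H3_def two_bridge_knot_group_def presented_group_def N_def by blast
  obtain \<psi> a b where \<psi>:
    "\<psi> \<in> hom (free_product (integer_mod_group 2) (integer_mod_group 3)) tetrahedral_group"
    and ab: "a \<in> carrier (free_product (integer_mod_group 2) (integer_mod_group 3))"
      "b \<in> carrier (free_product (integer_mod_group 2) (integer_mod_group 3))"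
      "\<psi> a ** \<psi> b \<noteq> \<psi> b ** \<psi> a"
    by (rule modular_group_to_tetrahedral)
  interpret F: group ?F by (rule group_free_group_on)
  have R_in: "{?R} \<subseteq> carrier ?F" unfolding carrier_free_group_on_UNIV by simp
  interpret normal N ?F
    unfolding N_def by (rule F.normal_closure_normal[OF R_in])
  define f where "f g = \<psi> (\<phi> (N #>\<^bsub>?F\<^esub> g))" for g
  have "f \<in> hom ?F tetrahedral_group"
    using hom_compose[OF hom_compose[OF r_coset_hom_Mod] \<psi>, of \<phi>] \<phi>
    by (simp add: epi_def comp_def f_def[abs_def])
  then have f_T: "f g \<in> tetrahedral" and f_add: "f (g + h) = f g ** f h" for g h
    unfolding hom_def carrier_free_group_on_UNIV by (simp_all add: tetrahedral_group_def Pi_def)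
  have f_zero: "f 0 = mat 1"
  proof -
    have idem: "f 0 ** f 0 = f 0"
      using f_add[of 0 0, symmetric] by (simp only: add_0_left)
    have "f 0 = transpose (f 0) ** f 0 ** f 0"
      using tetrahedral_transpose[OF f_T] by (simp only: matrix_mul_lid)
    also have "\<dots> = transpose (f 0) ** f 0"
      by (simp only: matrix_mul_assoc[symmetric] idem)
    also have "\<dots> = mat 1"
      using tetrahedral_transpose[OF f_T] by simp
    finally show ?thesis .
  qed
  have f_rep: "matrix_rep f" by (simp add: matrix_rep_def f_zero f_add)
  have coset: "N #>\<^bsub>?F\<^esub> g = N" if "g \<in> N" for g
    using subset that by (intro F.coset_join2[OF _ subgroup_axioms]) blast+
  have "?R \<in> N" unfolding N_def by (rule F.normal_closure_incl[OF R_in]) simp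
  moreover have "0 \<in> N" using one_closed by simp
  ultimately have "N #>\<^bsub>?F\<^esub> ?R = N #>\<^bsub>?F\<^esub> 0"
    by (simp only: coset)
  then have f_R: "f ?R = mat 1" using f_zero by (simp add: f_def)
  have onto: "\<exists>g. f g = \<psi> c" if "c \<in> carrier (free_product (integer_mod_group 2) (integer_mod_group 3))" for c
  proof -
    have "c \<in> \<phi> ` carrier (?F Mod N)" using \<phi> that by (simp only: epi_def mem_Collect_eq)
    then obtain k where k: "k \<in> rcosets\<^bsub>?F\<^esub> N" and c: "c = \<phi> k"
      unfolding FactGroup_def by auto
    from k obtain g where "k = N #>\<^bsub>?F\<^esub> g" unfolding RCOSETS_def by blast
    then have "f g = \<psi> c" by (simp only: f_def c)
    then show ?thesis ..
  qed
  obtain g h where gh: "f g ** f h \<noteq> f h ** f g"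
  proof -
    obtain g where g: "f g = \<psi> a" using onto[OF ab(1)] by blast
    obtain h where h: "f h = \<psi> b" using onto[OF ab(2)] by blast
    show ?thesis by (rule that[of g h]) (simp only: g h ab(3) not_False_eq_True)
  qed
  define U where "U = f (gen MX)"
  define V where "V = f (gen MY)"
  define W where "W = two_bridge_W \<alpha> \<beta>"
  \<comment> \<open>Otherwise the whole image of the knot group would be abelian.\<close>
  have noncomm: "U ** V \<noteq> V ** U"
  proof
    assume comm: "U ** V = V ** U"
    have gens: "f (gen c) ** f (gen d) = f (gen d) ** f (gen c)" for c d
      using comm by (cases c; cases d) (simp_all add: U_def V_def)
    have "f (gen d) ** f k = f k ** f (gen d)" for d k
      by (rule sym, rule matrix_rep_intertwine[OF f_rep f_rep], rule gens)
    then have "f g ** f h = f h ** f g"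
      by (rule matrix_rep_intertwine[OF f_rep f_rep])
    then show False using gh by blast
  qed
  have inv_W: "f (- W) = transpose (f W)"
    by (rule matrix_rep_uminus_tetrahedral[OF f_rep f_T])
  have "f W ** U ** f (- W) ** f (- gen MY) = mat 1"
    using f_R f_add[of "W + gen MX + - W" "- gen MY"]
    by (simp add: two_bridge_R_def W_def[symmetric] U_def f_add[symmetric])
  then have "f W ** U ** f (- W) ** (f (- gen MY) ** V) = V"
    by (simp add: matrix_mul_assoc)
  then have V: "V = f W ** U ** transpose (f W)"
    using matrix_rep_inverse[OF f_rep, of "gen MY"] by (simp add: V_def inv_W)
  define Q where "Q = intertwiner U V"
  have Q: "det Q \<noteq> 0" "U ** Q = Q ** X_matrix" "V ** Q = Q ** Y_matrix"
    using tetrahedral_intertwiner[OF f_T[of "gen MX", folded U_def] f_T V noncomm]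
    unfolding Q_def by blast+
  have "f (gen c) ** Q = Q ** eval_rep rho0 (gen c)" for c
    using Q by (cases c) (simp_all add: eval_rep_gen U_def V_def)
  then have "f ?R ** Q = Q ** eval_rep rho0 ?R"
    by (rule matrix_rep_intertwine[OF f_rep matrix_rep_eval_rep[of rho0, OF invertible_rho0]])
  then show ?thesis
    using matrix_mult_left_cancel_3[OF _ Q(1)] f_R by simp
qed


section \<open>Laurent polynomials in the cube of the variable\<close>

lemma poly_in_t_pow_pCons: "poly_in_t_pow (pCons a p) k = of_int a + t_pow k * poly_in_t_pow p k"
  by (simp add: poly_in_t_pow_def map_poly_pCons)

lemma poly_in_t_pow_0 [simp]: "poly_in_t_pow 0 k = 0"
  by (simp add: poly_in_t_pow_def)

lemma poly_in_t_pow_add: "poly_in_t_pow (p + q) k = poly_in_t_pow p k + poly_in_t_pow q k"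
proof -
  have "map_poly of_int (p + q) = (map_poly of_int p + map_poly of_int q :: laurent poly)"
    by (rule poly_eqI) (simp add: coeff_map_poly)
  then show ?thesis by (simp add: poly_in_t_pow_def)
qed

lemma poly_in_t_pow_mult: "poly_in_t_pow (p * q) k = poly_in_t_pow p k * poly_in_t_pow q k"
proof -
  have "map_poly of_int (p * q) = (map_poly of_int p * map_poly of_int q :: laurent poly)"
    by (rule poly_eqI) (simp add: coeff_map_poly coeff_mult)
  then show ?thesis by (simp add: poly_in_t_pow_def)
qed

lemma at_one_poly_in_t_pow: "at_one (poly_in_t_pow p k) = poly p 1"
  by (induction p) (simp_all add: poly_in_t_pow_pCons at_one_add at_one_mult at_one_of_int)

text \<open>
  The ring of Laurent polynomials in \<open>t^3\<close>. The exponent of the denominator is not unique, so that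
  two elements can be brought to a common one.
\<close>

definition cubic :: "laurent set" where
  "cubic = {t_pow (- (3 * int n)) * poly_in_t_pow p 3 | n p. True}"

text \<open>A larger power of \<open>t^3\<close> in the denominator is compensated by a power of the variable.\<close>

lemma cubic_raise:
  "t_pow (- (3 * int n)) * poly_in_t_pow p 3 =
    t_pow (- (3 * int (m + n))) * poly_in_t_pow ([:0, 1:] ^ m * p) 3"
proof -
  have "poly_in_t_pow ([:0, 1:] ^ m) 3 = t_pow (3 * int m)"
    by (induction m) (simp_all add: poly_in_t_pow_mult poly_in_t_pow_pCons mult_single one_pCons algebra_simps del: pCons_one)
  then have "t_pow (- (3 * int (m + n))) * poly_in_t_pow ([:0, 1:] ^ m * p) 3 =
      (t_pow (- (3 * int (m + n))) * t_pow (3 * int m)) * poly_in_t_pow p 3"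
    by (simp add: poly_in_t_pow_mult mult.assoc)
  then show ?thesis by (simp add: mult_single)
qed

lemma cubic_add: "p \<in> cubic \<Longrightarrow> q \<in> cubic \<Longrightarrow> p + q \<in> cubic"
proof -
  assume "p \<in> cubic" "q \<in> cubic"
  then obtain n p' m q' where "p = t_pow (- (3 * int n)) * poly_in_t_pow p' 3"
    and "q = t_pow (- (3 * int m)) * poly_in_t_pow q' 3"
    unfolding cubic_def by blast
  then have "p + q = t_pow (- (3 * int (m + n))) * poly_in_t_pow ([:0, 1:] ^ m * p' + [:0, 1:] ^ n * q') 3"
    using cubic_raise[of n p' m] cubic_raise[of m q' n]
    by (simp add: poly_in_t_pow_add distrib_left add.commute)
  then show ?thesis unfolding cubic_def by blast
qed

lemma cubic_mult: "p \<in> cubic \<Longrightarrow> q \<in> cubic \<Longrightarrow> p * q \<in> cubic"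
proof -
  assume "p \<in> cubic" "q \<in> cubic"
  then obtain n p' m q' where "p = t_pow (- (3 * int n)) * poly_in_t_pow p' 3"
    and "q = t_pow (- (3 * int m)) * poly_in_t_pow q' 3"
    unfolding cubic_def by blast
  then have "p * q = (t_pow (- (3 * int n)) * t_pow (- (3 * int m))) * poly_in_t_pow (p' * q') 3"
    by (simp add: poly_in_t_pow_mult mult_ac del: mult_single)
  also have "\<dots> = t_pow (- (3 * int (n + m))) * poly_in_t_pow (p' * q') 3"
    by (simp add: mult_single algebra_simps)
  finally show ?thesis unfolding cubic_def by blast
qed

lemma cubic_of_int [simp]: "of_int c \<in> cubic"
proof -
  have "of_int c = t_pow (- (3 * int 0)) * poly_in_t_pow [:c:] 3"
    by (simp add: poly_in_t_pow_pCons)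
  then show ?thesis unfolding cubic_def by blast
qed

lemma cubic_0 [simp]: "0 \<in> cubic" and cubic_1 [simp]: "1 \<in> cubic" and cubic_m1 [simp]: "-1 \<in> cubic"
  using cubic_of_int[of 0] cubic_of_int[of 1] cubic_of_int[of "-1"] by simp_all

lemma cubic_diff: "p \<in> cubic \<Longrightarrow> q \<in> cubic \<Longrightarrow> p - q \<in> cubic"
  using cubic_add[of p "-1 * q"] cubic_mult[of "-1" q] by simp

lemma cubic_t_pow_3 [simp]: "t_pow 3 \<in> cubic" and cubic_t_pow_m3 [simp]: "t_pow (-3) \<in> cubic"
proof -
  have "t_pow 3 = t_pow (- (3 * int 0)) * poly_in_t_pow [:0, 1:] 3"
    "t_pow (-3) = t_pow (- (3 * int 1)) * poly_in_t_pow [:1:] 3"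
    by (simp_all add: poly_in_t_pow_pCons mult_single)
  then show "t_pow 3 \<in> cubic" "t_pow (-3) \<in> cubic" unfolding cubic_def by blast+
qed

lemma cubic_sum: "(\<And>k. k \<in> K \<Longrightarrow> f k \<in> cubic) \<Longrightarrow> sum f K \<in> cubic"
  by (induction K rule: infinite_finite_induct) (simp_all add: cubic_add)


section \<open>Diagonalising the Klein four-group\<close>

text \<open>
  The diagonal matrix with entries \<open>t^2, t, 1\<close> times an integral matrix whose rows are simultaneous left
  eigenvectors of the image of the Klein four-group under \<open>rho0\<close>. The second factor \<open>Q\<close> satisfies
  \<open>Q X = C Q\<close> for the cyclic permutation matrix \<open>C\<close>, and \<open>Q Y = C' Q\<close> for a matrix \<open>C'\<close> that differs
  from \<open>C\<close> only by signs. A nonzero entry of \<open>C t\<close> or \<open>C' t\<close> then becomes \<open>\<plusminus> t^3\<close> or \<open>\<plusminus> 1\<close> on conjugation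
  by the first factor.
\<close>

definition grading_matrix :: "laurent^3^3" where
  "grading_matrix = mat3 (t_pow 2) (t_pow 2) (- t_pow 2) (t_pow 1) (- t_pow 1) (- t_pow 1) (-1) 1 (-1)"

text \<open>
  Conjugation by the grading matrix, which is invertible only over the field of fractions, gives
  entries in \<open>t^3\<close>.
\<close>

definition cubic_conjugate :: "laurent^3^3 \<Rightarrow> bool" where
  "cubic_conjugate P \<longleftrightarrow>
    (\<exists>M. (\<forall>i j. M $ i $ j \<in> cubic) \<and> grading_matrix ** P = M ** grading_matrix)"

lemma det_grading_matrix: "det grading_matrix \<noteq> 0"
proof -
  have "at_one (det grading_matrix) = 4"
    by (simp add: grading_matrix_def det_mat3 at_one_add at_one_diff at_one_mult)
  then show ?thesis by auto
qed

lemma cubic_conjugate_mult: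
  assumes "cubic_conjugate P" "cubic_conjugate P'"
  shows "cubic_conjugate (P ** P')"
proof -
  obtain M M' where M: "\<forall>i j. M $ i $ j \<in> cubic" "grading_matrix ** P = M ** grading_matrix"
    and M': "\<forall>i j. M' $ i $ j \<in> cubic" "grading_matrix ** P' = M' ** grading_matrix"
    using assms unfolding cubic_conjugate_def by blast
  have "\<forall>i j. (M ** M') $ i $ j \<in> cubic"
    using M(1) M'(1) by (auto simp: matrix_matrix_mult_def intro!: cubic_sum cubic_mult)
  moreover have "grading_matrix ** (P ** P') = (M ** M') ** grading_matrix"
  proof -
    have "grading_matrix ** (P ** P') = M ** (grading_matrix ** P')"
      by (simp only: M(2) matrix_mul_assoc)
    then show ?thesis by (simp only: M'(2) matrix_mul_assoc)
  qed
  ultimately show ?thesis unfolding cubic_conjugate_def by blast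
qed

lemma cubic_conjugate_add:
  assumes "cubic_conjugate P" "cubic_conjugate P'"
  shows "cubic_conjugate (P + P')"
proof -
  obtain M M' where M: "\<forall>i j. M $ i $ j \<in> cubic" "grading_matrix ** P = M ** grading_matrix"
    and M': "\<forall>i j. M' $ i $ j \<in> cubic" "grading_matrix ** P' = M' ** grading_matrix"
    using assms unfolding cubic_conjugate_def by blast
  have "grading_matrix ** (P + P') = (M + M') ** grading_matrix"
    by (simp add: matrix_add_ldistrib M(2) M'(2)) 
      (simp add: matrix_matrix_mult_def vec_eq_iff sum.distrib distrib_right)
  then show ?thesis
    using M(1) M'(1) unfolding cubic_conjugate_def by (intro exI[of _ "M + M'"]) (simp add: cubic_add)
qed

lemma cubic_conjugate_mat:
  assumes "c \<in> cubic"
  shows "cubic_conjugate (mat c)"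
proof -
  have "grading_matrix ** mat c = mat c ** grading_matrix"
    by (simp add: mat_mult_left) (simp add: vec_eq_iff matrix_matrix_mult_def mat_def if_distrib mult.commute cong: if_cong)
  then show ?thesis
    unfolding cubic_conjugate_def using assms by (intro exI[of _ "mat c"]) (simp add: mat_def)
qed

lemma cubic_conjugate_inverse:
  assumes "grading_matrix ** P = M ** grading_matrix" "M' ** M = mat 1" "P ** P' = mat 1"
    and "\<forall>i j. M' $ i $ j \<in> cubic"
  shows "cubic_conjugate P'"
proof -
  have "grading_matrix ** P' = M' ** (M ** grading_matrix) ** P'"
    using assms(2) by (simp add: matrix_mul_assoc)
  also have "\<dots> = M' ** grading_matrix ** (P ** P')"
    unfolding assms(1)[symmetric] by (simp add: matrix_mul_assoc)
  also have "\<dots> = M' ** grading_matrix" using assms(3) by simp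
  finally show ?thesis unfolding cubic_conjugate_def using assms(4) by blast
qed

lemma times_t_mat3: "times_t (mat3 a b c d e f g h i) =
    mat3 (of_int a * t_pow 1) (of_int b * t_pow 1) (of_int c * t_pow 1) (of_int d * t_pow 1)
      (of_int e * t_pow 1) (of_int f * t_pow 1) (of_int g * t_pow 1) (of_int h * t_pow 1) (of_int i * t_pow 1)"
  by (simp add: vec_eq_iff forall_3 times_t_def)

lemma cubic_conjugate_letter: "cubic_conjugate (letter_matrix rho0 l)"
proof -
  have main: "cubic_conjugate (times_t (rho0 a)) \<and> cubic_conjugate (matrix_inv (times_t (rho0 a)))"
    if M: "grading_matrix ** times_t (rho0 a) = M ** grading_matrix" "M' ** M = mat 1"
      "\<forall>i j. M $ i $ j \<in> cubic" "\<forall>i j. M' $ i $ j \<in> cubic" for a M M'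
    using cubic_conjugate_inverse[OF M(1,2) _ M(4)] matrix_inv_inverse[OF invertible_times_t[OF invertible_rho0]]
      M(1,3) unfolding cubic_conjugate_def by blast
  have "cubic_conjugate (times_t (rho0 a)) \<and> cubic_conjugate (matrix_inv (times_t (rho0 a)))" for a
  proof (cases a)
    case MX
    show ?thesis
      by (rule main[of _ "mat3 0 0 (t_pow 3) 1 0 0 0 1 0" "mat3 0 1 0 0 0 1 (t_pow (-3)) 0 0"])
        (simp_all add: MX X_matrix_mat3 times_t_mat3 grading_matrix_def mat3_simps mult_single forall_3)
  next
    case MY
    show ?thesis
      by (rule main[of _ "mat3 0 0 (t_pow 3) (-1) 0 0 0 (-1) 0" "mat3 0 (-1) 0 0 0 (-1) (t_pow (-3)) 0 0"])
        (simp_all add: MY Y_matrix_mat3 times_t_mat3 grading_matrix_def mat3_simps mult_single forall_3)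
  qed
  then show ?thesis by (cases l) simp
qed

lemma cubic_conjugate_Phi: "cubic_conjugate (Phi rho0 p)"
proof (induction p rule: poly_mapping_additive_induct)
  case 1
  have "mat 0 = (0 :: laurent^3^3)" by (simp add: mat_def vec_eq_iff)
  then show ?case using cubic_conjugate_mat[of 0] by (simp add: Phi_def)
next
  case (2 g c)
  have "cubic_conjugate (foldr (\<lambda>l M. letter_matrix rho0 l ** M) w (mat 1))" for w
    by (induction w) (simp_all add: cubic_conjugate_mat cubic_conjugate_mult cubic_conjugate_letter)
  then show ?case
    unfolding Phi_single element_matrix_def by (intro cubic_conjugate_mult cubic_conjugate_mat) simp
next
  case (3 p q)
  then show ?case by (simp add: Phi_add cubic_conjugate_add)
qed

lemma det_Phi_cubic: "det (Phi rho0 p) \<in> cubic"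
proof -
  obtain M where M: "\<forall>i j. M $ i $ j \<in> cubic" "grading_matrix ** Phi rho0 p = M ** grading_matrix"
    using cubic_conjugate_Phi unfolding cubic_conjugate_def by blast
  have "det grading_matrix * det (Phi rho0 p) = det grading_matrix * det M"
    using M(2) by (metis det_mul mult.commute)
  then have "det (Phi rho0 p) = det M" using det_grading_matrix by simp
  then show ?thesis using M(1) by (simp add: det_3 cubic_add cubic_diff cubic_mult)
qed


section \<open>Vanishing at one\<close>

lemma at_one_det_Phi_fox:
  assumes "eval_rep rho0 R = mat 1"
  shows "at_one (det (Phi rho0 (fox MX R))) = 0"
proof -
  let ?A = "map_at_one (Phi rho0 (fox MX R))" and ?B = "map_at_one (Phi rho0 (fox MY R))"
  have "Phi rho0 (fox MX R) ** (times_t X_matrix - mat 1) + Phi rho0 (fox MY R) ** (times_t Y_matrix - mat 1)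
      = element_matrix rho0 R - mat 1"
    using arg_cong[OF fox_fundamental[of R], of "Phi rho0"]
    by (simp add: Phi_add Phi_mult[of rho0, OF invertible_rho0] Phi_minus Phi_one Phi_gen)
      (simp add: Phi_single)
  from arg_cong[OF this, of map_at_one]
  have "?A ** (X_matrix - mat 1) + ?B ** (Y_matrix - mat 1) = eval_rep rho0 R - mat 1"
    by (simp only: eval_rep_def map_at_one_add map_at_one_diff map_at_one_mult map_at_one_1
        map_at_one_times_t)
  \<comment> \<open>The second basis vector is fixed by \<open>Y\<close> and mapped to the first one by \<open>X\<close>.\<close>
  then have "(?A ** (X_matrix - mat 1) + ?B ** (Y_matrix - mat 1)) $ i $ 2 = 0" for i
    using assms by simp
  then have "?A $ i $ 1 = ?A $ i $ 2" for i
    by (simp add: matrix_matrix_mult_def sum_3 X_matrix_mat3 Y_matrix_mat3 mat_1_mat3)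
  then have "det ?A = 0" by (simp add: det_3)
  then show ?thesis by (simp add: det_map_at_one)
qed


section \<open>The twisted Alexander polynomial\<close>

theorem theorem3p1:
  fixes \<alpha> \<beta> :: nat
  assumes "odd \<alpha>" and "odd \<beta>" and "coprime \<alpha> \<beta>" and "0 < \<beta>" and "\<beta> < \<alpha>"
    and "in_H3 \<alpha> \<beta>"
  shows "\<exists>\<phi> :: int poly.
    twisted_alexander rho0 (two_bridge_R \<alpha> \<beta>) \<doteq> Fract (poly_in_t_pow \<phi> 3) 1"
proof -
  let ?D = "det (Phi rho0 (fox MX (two_bridge_R \<alpha> \<beta>)))"
  obtain n p where D: "?D = t_pow (- (3 * int n)) * poly_in_t_pow p 3"
    using det_Phi_cubic[of "fox MX (two_bridge_R \<alpha> \<beta>)"] unfolding cubic_def by blast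
  have "at_one ?D = 0"
    by (rule at_one_det_Phi_fox[OF rho0_two_bridge_R[OF assms(6)]])
  then have "poly p 1 = 0"
    unfolding D by (simp add: at_one_mult at_one_poly_in_t_pow)
  then obtain \<phi> where p: "p = [:-1, 1:] * \<phi>"
    unfolding poly_eq_0_iff_dvd by blast
  have "poly_in_t_pow p 3 = (t_pow 3 - 1) * poly_in_t_pow \<phi> 3"
    unfolding p poly_in_t_pow_mult by (simp add: poly_in_t_pow_pCons)
  then have "?D * 1 = t_pow (- (3 * int n)) * poly_in_t_pow \<phi> 3 * (t_pow 3 - 1)"
    unfolding D by (simp add: mult_ac)
  moreover have "t_pow 3 - 1 \<noteq> 0"
  proof
    assume "t_pow 3 - 1 = 0"
    then have "Poly_Mapping.lookup (t_pow 3 - 1) 3 = 0" by simp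
    then show False by (simp add: lookup_minus lookup_single lookup_one)
  qed
  ultimately have "Fract ?D (t_pow 3 - 1) = Fract (t_pow (- (3 * int n)) * poly_in_t_pow \<phi> 3) 1"
    by (subst eq_fract(1)) (simp_all del: mult_single)
  then have "twisted_alexander rho0 (two_bridge_R \<alpha> \<beta>) =
      Fract (1 * t_pow (- (3 * int n))) 1 * Fract (poly_in_t_pow \<phi> 3) 1"
    unfolding twisted_alexander_def det_Phi_y_minus_1 by simp
  then show ?thesis unfolding eq_up_to_unit_def by blast
qed

end
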